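(* Let $X:[0,\infty)\to\mathbb{R}^n$ be a càdlàg function and let $i\in\{1,\ldots,n\}$. If either $M_i(X)$ or $N_i(X)$ is unbounded on $[0,\infty)$, or equivalently if $$\liminf_{t\to\infty}X_i(t)=-\infty\quad\text{or}\quad \liminf_{t\to\infty}(R^{-1}X(t))_i=-\infty$$ (respectively), then for every $a\in[0,\infty)^n$ $$\lim_{t\to\infty}\bigl(W_i(a+X)(t)-W_i(X)(t)\bigr)=0 .$$
   Context: Fix $n\ge 1$ and an $n\times n$ matrix $P=(p_{ij})$ with nonnegative entries and spectral radius strictly less than one. Put $R=I-P^t$, where $^t$ denotes transposition (so $R$ is invertible with $R^{-1}$ entrywise nonnegative). For a càdlàg (right continuous with left limits) function $X:[0,\infty)\to\mathbb{R}^n$, the reflection map (Skorohod problem in $[0,\infty)^n$) gives the unique pair $(W(X),L(X))$ of $\mathbb{R}^n$-valued functions on $[0,\infty)$ with $W(X)(t)=X(t)+R\,L(X)(t)$ for all $t\ge 0$ and, for each $i=1,\ldots,n$: (S1) $L_i(X)$ is nondecreasing, nonnegative and right continuous; (S2) $W_i(X)$ is nonnegative; (S3) $\int_{[0,\infty)}1_{\{W_i(X)(t)>0\}}\,dL_i(X)(t)=0$, where the measure $dL_i(X)$ has an atom of mass $L_i(X)(0)$ at $0$. (It is known that this pair exists and is unique.) A subscript $i$ denotes the $i$th coordinate, and for a constant vector $a$, $a+X$ denotes the function $t\mapsto a+X(t)$. With the convention $x^-=\min(x,0)$ for $x\in\mathbb{R}$, define for $t\ge 0$ $$M_i(X)(t)=-\inf_{0\le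 s\le t}X_i(s)^-,\qquad N_i(X)(t)=-\inf_{0\le s\le t}\bigl((R^{-1}X(s))_i\bigr)^- .$$ *)

theory Defs
  imports "HOL-Analysis.Analysis"
begin

text \<open>
  Paths on \<open>[0,\<infinity>)\<close> are represented by functions on all of \<open>real\<close>; every notion below depends
  only on their values on \<open>{0..}\<close>.
\<close>

definition cadlag :: "(real \<Rightarrow> 'a::topological_space) \<Rightarrow> bool" where
  "cadlag X \<longleftrightarrow>
     (\<forall>t\<ge>0. (X \<longlongrightarrow> X t) (at_right t)) \<and> (\<forall>t>0. \<exists>l. (X \<longlongrightarrow> l) (at_left t))"

text \<open>
  The set of (complex) eigenvalues of a real square matrix. It is finite and nonempty, so the
  supremum in the definition of the spectral radius is a maximum.
\<close>

definition eigenvalues :: "real^'n^'n \<Rightarrow> complex set" where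
  "eigenvalues A = {l. \<exists>v::complex^'n. v \<noteq> 0 \<and> map_matrix complex_of_real A *v v = l *s v}"

definition spec_radius :: "real^'n^'n \<Rightarrow> real" where
  "spec_radius A = (SUP l\<in>eigenvalues A. norm l)"

definition reflection_matrix :: "real^'n^'n \<Rightarrow> real^'n^'n" where
  "reflection_matrix P = mat 1 - transpose P"

text \<open>
  The Lebesgue--Stieltjes measure of \<open>f\<close> on \<open>[0,\<infinity>)\<close>. Extending \<open>f\<close> by \<open>0\<close> to the negative
  half-line gives the measure the required atom of mass \<open>f 0\<close> at \<open>0\<close>.
\<close>

definition stieltjes_measure :: "(real \<Rightarrow> real) \<Rightarrow> real measure" where
  "stieltjes_measure f = interval_measure (\<lambda>t. if t < 0 then 0 else f t)"

text \<open>
  \<open>is_reflection P X W L\<close> states that \<open>(W, L)\<close> solves the Skorohod problem in the nonnegative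
  orthant for the path \<open>X\<close>, that is, \<open>(W, L) = (W(X), L(X))\<close> on \<open>[0,\<infinity>)\<close>.
\<close>

definition is_reflection ::
    "real^'n^'n \<Rightarrow> (real \<Rightarrow> real^'n) \<Rightarrow> (real \<Rightarrow> real^'n) \<Rightarrow> (real \<Rightarrow> real^'n) \<Rightarrow> bool" where
  "is_reflection P X W L \<longleftrightarrow>
     (\<forall>t\<ge>0. W t = X t + reflection_matrix P *v L t) \<and>
     (\<forall>i. mono_on {0..} (\<lambda>t. L t $ i) \<and>
          (\<forall>t\<ge>0. 0 \<le> L t $ i) \<and>
          (\<forall>t\<ge>0. ((\<lambda>s. L s $ i) \<longlongrightarrow> L t $ i) (at_right t)) \<and>
          (\<forall>t\<ge>0. 0 \<le> W t $ i) \<and>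
          (\<integral>\<^sup>+t\<in>{0..}. indicator {s. W s $ i > 0} t \<partial>stieltjes_measure (\<lambda>t. L t $ i)) = 0)"

definition M_path :: "(real \<Rightarrow> real^'n) \<Rightarrow> 'n \<Rightarrow> real \<Rightarrow> real" where
  "M_path X i t = - (INF s\<in>{0..t}. min (X s $ i) 0)"

definition N_path :: "real^'n^'n \<Rightarrow> (real \<Rightarrow> real^'n) \<Rightarrow> 'n \<Rightarrow> real \<Rightarrow> real" where
  "N_path P X i t = - (INF s\<in>{0..t}. min ((matrix_inv (reflection_matrix P) *v X s) $ i) 0)"

end

theory Submission
  imports Defs
begin

text \<open>
  Write \<open>R = I - P\<^sup>t\<close>, let \<open>(W, L)\<close> and \<open>(W', L')\<close> be the reflections of \<open>X\<close> and \<open>a + X\<close>, and put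
  \<open>D = L - L'\<close>, so that \<open>W' - W = a - R D = A - D\<close> with \<open>A = a + P\<^sup>t D\<close>. Starting higher means
  less pushing: the heart of the matter is that every component of \<open>D\<close> is nonnegative,
  nondecreasing (\<open>D0_mono\<close>) and bounded by that of \<open>R\<^sup>-\<^sup>1 a\<close> (\<open>D_bounded\<close>). Hence \<open>D\<close>, and with it
  \<open>W' - W\<close>, converges, and only the value of the limit is in question. If \<open>X\<^sub>i\<close> or \<open>(R\<^sup>-\<^sup>1 X)\<^sub>i\<close> is
  unbounded below, then nonnegativity of \<open>W\<close> and of \<open>R\<^sup>-\<^sup>1 W\<close> forces \<open>L\<^sub>i\<close> and \<open>L'\<^sub>i\<close> to be
  unbounded, so \<open>W\<^sub>i\<close> and \<open>W'\<^sub>i\<close> both vanish at arbitrarily late times. Where \<open>W\<^sub>i\<close> vanishes,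
  \<open>W'\<^sub>i - W\<^sub>i \<ge> 0\<close>; where \<open>W'\<^sub>i\<close> vanishes, \<open>W'\<^sub>i - W\<^sub>i \<le> 0\<close>; the limit is therefore \<open>0\<close>.

  Two tools carry the monotonicity of \<open>D\<close>. The spectral condition enters only through inverse
  positivity, \<open>R x \<le> 0 \<Longrightarrow> x \<le> 0\<close> (\<open>reflection_matrix_monotone\<close>), which comes from
  a Perron--Frobenius argument based on Brouwer's fixed point theorem. The complementarity
  integral enters only through \<open>reflection_zero_above_level\<close>: whenever \<open>L\<^sub>i\<close> exceeds a
  nonnegative level, it has been at or above that level, at that time or before, when \<open>W\<^sub>i\<close> was
  zero. At zeros of \<open>W\<^sub>i\<close> one
  has \<open>D\<^sub>i \<le> A\<^sub>i\<close>, at zeros of \<open>W'\<^sub>i\<close> one has \<open>D\<^sub>i \<ge> A\<^sub>i\<close>; comparing such times bounds the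
  largest drop \<open>e\<close> of \<open>D\<close> by \<open>e \<le> P\<^sup>t e\<close>, and inverse positivity gives \<open>e \<le> 0\<close>.
\<close>

section \<open>Inverse positivity of the reflection matrix\<close>

text \<open>
  The normalised map \<open>x \<mapsto> Q x / |Q x|\<^sub>1\<close> preserves the set of probability vectors with
  \<open>x \<le> Q x\<close>, which is compact and convex, and nonempty because it contains a multiple of \<open>e\<close>.
  A Brouwer fixed point is an eigenvector, with eigenvalue \<open>|Q x|\<^sub>1 \<ge> |x|\<^sub>1 = 1\<close>.
\<close>

lemma subinvariant_vector_imp_eigenvector:
  fixes Q :: "real^'n^'n" and e :: "real^'n"
  assumes Q: "\<And>j k. 0 \<le> Q $ j $ k"
    and e: "\<And>j. 0 \<le> e $ j" "e \<noteq> 0" "\<And>j. e $ j \<le> (Q *v e) $ j"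
  obtains l x where "1 \<le> l" "x \<noteq> 0" "Q *v x = l *\<^sub>R x"
proof -
  define S where "S = {x::real^'n. (\<forall>j. 0 \<le> x $ j) \<and> (\<Sum>j\<in>UNIV. x $ j) = 1 \<and> (\<forall>j. x $ j \<le> (Q *v x) $ j)}"
  define m where "m x = (\<Sum>j\<in>UNIV. (Q *v x) $ j)" for x
  have cont: "continuous_on T (\<lambda>x. (Q *v x) $ j)" for j and T :: "(real^'n) set"
    by (simp add: matrix_vector_mult_def) (intro continuous_intros)
  have "closed S"
    unfolding S_def by (intro closed_Collect_conj closed_Collect_all closed_Collect_le
        closed_Collect_eq continuous_intros cont)
  moreover have "bounded S"
  proof (rule boundedI)
    fix x assume "x \<in> S"
    then show "norm x \<le> 1"
      using norm_le_l1_cart[of x] by (simp add: S_def)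
  qed
  ultimately have "compact S" by (simp add: compact_eq_bounded_closed)
  moreover have "convex S"
    by (rule convexI)
      (auto simp: S_def matrix_vector_right_distrib matrix_vector_mult_scaleR sum.distrib
        sum_distrib_left[symmetric] intro!: add_mono mult_left_mono)
  moreover have "S \<noteq> {}"
  proof -
    have "0 < (\<Sum>j\<in>UNIV. e $ j)"
      using e(1,2) by (auto simp: vec_eq_iff less_le sum_nonneg sum_nonneg_eq_0_iff)
    then have "(1 / (\<Sum>j\<in>UNIV. e $ j)) *\<^sub>R e \<in> S"
      using e(1,3) by (auto simp: S_def matrix_vector_mult_scaleR sum_divide_distrib[symmetric]
          intro!: divide_right_mono)
    then show ?thesis by blast
  qed
  moreover have m_ge: "1 \<le> m x" if "x \<in> S" for x
    using that sum_mono[of UNIV "\<lambda>j. x $ j" "\<lambda>j. (Q *v x) $ j"] by (auto simp: S_def m_def)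
  moreover have "continuous_on S (\<lambda>x. (1 / m x) *\<^sub>R (Q *v x))"
  proof -
    have "continuous_on S m" unfolding m_def by (intro continuous_intros cont)
    moreover have "continuous_on S (\<lambda>x. Q *v x)"
      by (simp add: linear_continuous_on matrix_vector_mul_bounded_linear)
    moreover have "m x \<noteq> 0" if "x \<in> S" for x using m_ge[OF that] by simp
    ultimately show ?thesis by (intro continuous_intros) auto
  qed
  moreover have "(\<lambda>x. (1 / m x) *\<^sub>R (Q *v x)) \<in> S \<rightarrow> S"
  proof
    fix x assume x: "x \<in> S"
    have "0 \<le> (Q *v x) $ j" for j
      using x by (simp add: S_def) (meson order_trans)
    moreover have "(Q *v x) $ j \<le> (Q *v (Q *v x)) $ j" for j
    proof -
      have "(\<Sum>k\<in>UNIV. Q $ j $ k * x $ k) \<le> (\<Sum>k\<in>UNIV. Q $ j $ k * (Q *v x) $ k)"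
        using x Q by (intro sum_mono mult_left_mono) (auto simp: S_def)
      then show ?thesis by (simp add: matrix_vector_mult_def)
    qed
    ultimately show "(1 / m x) *\<^sub>R (Q *v x) \<in> S"
      using m_ge[OF x] by (auto simp: S_def matrix_vector_mult_scaleR m_def
          sum_divide_distrib[symmetric] intro!: divide_right_mono)
  qed
  ultimately obtain x where x: "x \<in> S" "(1 / m x) *\<^sub>R (Q *v x) = x"
    using brouwer[of S "\<lambda>x. (1 / m x) *\<^sub>R (Q *v x)"] by blast
  have "Q *v x = m x *\<^sub>R ((1 / m x) *\<^sub>R (Q *v x))"
    using m_ge[OF x(1)] by simp
  then have "Q *v x = m x *\<^sub>R x" by (simp only: x(2))
  moreover have "x \<noteq> 0" using x(1) by (auto simp: S_def)
  ultimately show thesis using that m_ge[OF x(1)] by blast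
qed

lemma real_eigenvalue_le_spec_radius:
  fixes P :: "real^'n^'n"
  assumes x: "x \<noteq> 0" "P *v x = l *\<^sub>R x"
  shows "\<bar>l\<bar> \<le> spec_radius P"
proof -
  define v :: "complex^'n" where "v = (\<chi> j. complex_of_real (x $ j))"
  have "map_matrix complex_of_real P *v v = complex_of_real l *s v"
    using x(2) by (simp add: v_def vec_eq_iff matrix_vector_mult_def map_matrix_def
        flip: of_real_mult of_real_sum)
  moreover have "v \<noteq> 0" using x(1) by (auto simp: v_def vec_eq_iff)
  ultimately have l: "complex_of_real l \<in> eigenvalues P"
    unfolding eigenvalues_def by blast
  \<comment> \<open>The supremum defining the spectral radius is only meaningful once the set of eigenvalues is
    known to be bounded; an operator norm bound suffices.\<close>
  have "linear (\<lambda>w. map_matrix complex_of_real P *v w)"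
    by (rule linearI) (simp_all add: matrix_vector_right_distrib vec_eq_iff
        matrix_vector_mult_def scaleR_sum_right distrib_left sum.distrib)
  then obtain K where K: "\<And>w. norm (map_matrix complex_of_real P *v w) \<le> K * norm w"
    using linear_bounded by blast
  have "norm z \<le> K" if "z \<in> eigenvalues P" for z
  proof -
    from that obtain w where w: "w \<noteq> 0" "map_matrix complex_of_real P *v w = z *s w"
      by (auto simp: eigenvalues_def)
    have "norm (z *s w) = norm z * norm w"
      by (simp add: norm_vec_def norm_mult L2_set_right_distrib)
    then show ?thesis using K[of w] w by simp
  qed
  then have "bdd_above (norm ` eigenvalues P)" by (intro bdd_aboveI2)
  from cSUP_upper[OF l this] show ?thesis by (simp add: spec_radius_def)
qed

lemma real_eigenvalue_transpose:
  fixes P :: "real^'n^'n"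
  assumes "x \<noteq> 0" "transpose P *v x = l *\<^sub>R x"
  obtains y where "y \<noteq> 0" "P *v y = l *\<^sub>R y"
proof -
  have l: "l *\<^sub>R y = (l *\<^sub>R mat 1) *v y" for y :: "real^'n"
    by (simp add: scaleR_matrix_vector_assoc[symmetric])
  have t: "transpose (l *\<^sub>R mat 1 :: real^'n^'n) = l *\<^sub>R mat 1"
    by (simp add: transpose_def mat_def vec_eq_iff)
  have tr: "transpose (P - l *\<^sub>R mat 1) = transpose P - l *\<^sub>R mat 1"
    using t by (simp add: transpose_def vec_eq_iff)
  have "(transpose P - l *\<^sub>R mat 1) *v x = 0"
    using assms by (simp add: matrix_vector_mult_diff_rdistrib flip: l)
  then have "\<not> invertible (transpose (P - l *\<^sub>R mat 1))"
    using assms(1) unfolding tr invertible_left_inverse matrix_left_invertible_ker by blast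
  then have "\<not> invertible (P - l *\<^sub>R mat 1)"
    by (simp add: invertible_det_nz)
  then obtain y where "y \<noteq> 0" "(P - l *\<^sub>R mat 1) *v y = 0"
    unfolding invertible_left_inverse matrix_left_invertible_ker by blast
  then show thesis
    using that by (simp add: matrix_vector_mult_diff_rdistrib flip: l)
qed

lemma reflection_matrix_component:
  "(reflection_matrix P *v x) $ i = x $ i - (transpose P *v x) $ i"
  by (simp add: reflection_matrix_def matrix_vector_mult_diff_rdistrib)

lemma transpose_mult_mono:
  fixes P :: "real^'n^'n"
  assumes "\<forall>j k. 0 \<le> P $ j $ k" "\<And>j. x $ j \<le> y $ j"
  shows "(transpose P *v x) $ i \<le> (transpose P *v y) $ i"
  using assms by (auto simp: matrix_vector_mult_def transpose_def intro!: sum_mono mult_left_mono)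

text \<open>
  If \<open>x \<le> P\<^sup>t x\<close>, then the positive part \<open>e\<close> of \<open>x\<close> also satisfies \<open>e \<le> P\<^sup>t e\<close>. Were \<open>e\<close> nonzero,
  \<open>P\<^sup>t\<close>, and hence \<open>P\<close>, would have an eigenvalue at least \<open>1\<close>.
\<close>

lemma reflection_matrix_monotone:
  fixes P :: "real^'n^'n"
  assumes P: "\<forall>j k. 0 \<le> P $ j $ k" "spec_radius P < 1"
    and x: "\<And>j. (reflection_matrix P *v x) $ j \<le> 0"
  shows "x $ i \<le> 0"
proof -
  define e :: "real^'n" where "e = (\<chi> j. max 0 (x $ j))"
  have e_le: "e $ j \<le> (transpose P *v e) $ j" for j
  proof -
    have "x $ j \<le> (transpose P *v x) $ j"
      using x[of j] by (simp add: reflection_matrix_component)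
    also have "\<dots> \<le> (transpose P *v e) $ j"
      by (rule transpose_mult_mono[OF P(1)]) (simp add: e_def)
    finally show ?thesis
      using transpose_mult_mono[OF P(1), of 0 e j] by (simp add: e_def)
  qed
  have "e = 0"
  proof (rule ccontr)
    assume "e \<noteq> 0"
    moreover have "0 \<le> transpose P $ j $ k" for j k using P(1) by (simp add: transpose_def)
    moreover have "0 \<le> e $ j" for j by (simp add: e_def)
    ultimately obtain l y where "1 \<le> l" "y \<noteq> 0" "transpose P *v y = l *\<^sub>R y"
      using e_le subinvariant_vector_imp_eigenvector[of "transpose P" e] by blast
    moreover from this obtain z where "z \<noteq> 0" "P *v z = l *\<^sub>R z"
      using real_eigenvalue_transpose by blast
    ultimately show False
      using real_eigenvalue_le_spec_radius[of z P l] P(2) by simp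
  qed
  then have "max 0 (x $ i) = 0" by (simp add: e_def vec_eq_iff)
  then show ?thesis by simp
qed

text \<open>Applying monotonicity to a kernel vector and to its negative shows that \<open>R\<close> is injective.\<close>

lemma
  fixes P :: "real^'n^'n"
  assumes P: "\<forall>j k. 0 \<le> P $ j $ k" "spec_radius P < 1"
  shows reflection_matrix_inv_left: "matrix_inv (reflection_matrix P) *v (reflection_matrix P *v x) = x"
    and reflection_matrix_inv_right: "reflection_matrix P *v (matrix_inv (reflection_matrix P) *v x) = x"
proof -
  have "y = 0" if "reflection_matrix P *v y = 0" for y
  proof -
    have "y $ i \<le> 0" for i using reflection_matrix_monotone[OF P] that by simp
    moreover have "reflection_matrix P *v (- y) = 0"
      using that matrix_vector_mult_diff_distrib[of "reflection_matrix P" 0 y] by simp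
    then have "(- y) $ i \<le> 0" for i using reflection_matrix_monotone[OF P, of "- y"] by simp
    ultimately show ?thesis by (simp add: vec_eq_iff order_antisym)
  qed
  then have "invertible (reflection_matrix P)"
    by (auto simp: invertible_left_inverse matrix_left_invertible_ker)
  then have "reflection_matrix P ** matrix_inv (reflection_matrix P) = mat 1 \<and>
      matrix_inv (reflection_matrix P) ** reflection_matrix P = mat 1"
    unfolding invertible_def matrix_inv_def by (rule someI_ex)
  then show "matrix_inv (reflection_matrix P) *v (reflection_matrix P *v x) = x"
    and "reflection_matrix P *v (matrix_inv (reflection_matrix P) *v x) = x"
    by (simp_all add: matrix_vector_mul_assoc)
qed

lemma reflection_matrix_inv_nonneg:
  fixes P :: "real^'n^'n"
  assumes P: "\<forall>j k. 0 \<le> P $ j $ k" "spec_radius P < 1" and b: "\<And>j. 0 \<le> b $ j"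
  shows "0 \<le> (matrix_inv (reflection_matrix P) *v b) $ i"
proof -
  let ?x = "matrix_inv (reflection_matrix P) *v b"
  have "reflection_matrix P *v (- ?x) = - b"
    using matrix_vector_mult_diff_distrib[of "reflection_matrix P" 0 ?x]
    by (simp add: reflection_matrix_inv_right[OF P])
  then have "(- ?x) $ i \<le> 0"
    using reflection_matrix_monotone[OF P, of "- ?x"] b by simp
  then show ?thesis by simp
qed

section \<open>Unboundedness below of a path\<close>

lemma cadlag_continuous_compose:
  fixes g :: "'a::topological_space \<Rightarrow> 'b::topological_space"
  assumes "cadlag X" "continuous_on UNIV g"
  shows "cadlag (\<lambda>t. g (X t))"
proof -
  have "((\<lambda>t. g (X t)) \<longlongrightarrow> g l) F" if "(X \<longlongrightarrow> l) F" for l F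
    using continuous_on_tendsto_compose[OF assms(2) that] by simp
  then show ?thesis using assms(1) unfolding cadlag_def by blast
qed

text \<open>
  One-sided limits give a lower bound near each point, and bisection patches these bounds
  together. Intervals are cut down to \<open>{0..}\<close> because nothing is known to the left of \<open>0\<close>.
\<close>

lemma cadlag_bdd_below:
  fixes f :: "real \<Rightarrow> real"
  assumes f: "cadlag f"
  shows "bdd_below (f ` {0..t})"
proof (cases "0 \<le> t")
  case True
  have tends: "\<exists>d>0. \<exists>c. \<forall>y\<in>{x<..<x+d}. c \<le> f y" if "0 \<le> x" for x
  proof -
    have "eventually (\<lambda>y. f x - 1 < f y) (at_right x)"
      using f that order_tendstoD(1)[of f "f x" "at_right x" "f x - 1"] by (auto simp: cadlag_def)
    then obtain b where "b > x" "\<And>y. x < y \<Longrightarrow> y < b \<Longrightarrow> f x - 1 < f y"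
      unfolding eventually_at_right_field by blast
    then show ?thesis
      by (intro exI[of _ "b - x"] conjI exI[of _ "f x - 1"]) (auto intro: less_imp_le)
  qed
  have left: "\<exists>d>0. \<exists>c. \<forall>y\<in>{x-d<..<x} \<inter> {0..}. c \<le> f y" if "0 \<le> x" for x
  proof (cases "x = 0")
    case True then show ?thesis by (intro exI[of _ 1]) auto
  next
    case False
    with that have "0 < x" by simp
    with f obtain l where "(f \<longlongrightarrow> l) (at_left x)" unfolding cadlag_def by blast
    then have "eventually (\<lambda>y. l - 1 < f y) (at_left x)"
      using order_tendstoD(1)[of f l "at_left x" "l - 1"] by auto
    then obtain b where "b < x" "\<And>y. b < y \<Longrightarrow> y < x \<Longrightarrow> l - 1 < f y"
      unfolding eventually_at_left_field by blast
    then show ?thesis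
      by (intro exI[of _ "x - b"] conjI exI[of _ "l - 1"]) (auto intro: less_imp_le)
  qed
  define bounded_on where "bounded_on a b \<longleftrightarrow> bdd_below (f ` ({a..b} \<inter> {0..}))" for a b
  have "bounded_on 0 t"
    using True
  proof (induction rule: Bolzano)
    case (trans a b c)
    have "bdd_below (f ` ({a..b} \<inter> {0..} \<union> {b..c} \<inter> {0..}))"
      using trans(1,2) by (simp only: bounded_on_def image_Un bdd_below_Un)
    moreover have "{a..b} \<inter> {0..} \<union> {b..c} \<inter> {0..} = {a..c} \<inter> {0..}"
      using trans(3,4) by auto
    ultimately show ?case by (simp add: bounded_on_def)
  next
    case (local x)
    obtain d c where d: "d > 0" "\<forall>y\<in>{x<..<x+d}. c \<le> f y" using tends local by blast
    obtain d' c' where d': "d' > 0" "\<forall>y\<in>{x-d'<..<x} \<inter> {0..}. c' \<le> f y" using left local by blast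
    show ?case
    proof (intro exI[of _ "min d d'"] conjI allI impI)
      fix a b assume ab: "a \<le> x \<and> x \<le> b \<and> b - a < min d d'"
      show "bounded_on a b"
        unfolding bounded_on_def
      proof (rule bdd_belowI2[where m = "min (f x) (min c c')"])
        fix y assume y: "y \<in> {a..b} \<inter> {0..}"
        consider "y < x" | "y = x" | "x < y" by linarith
        then show "min (f x) (min c c') \<le> f y"
        proof cases
          case 1
          then have "y \<in> {x-d'<..<x} \<inter> {0..}" using y ab by auto
          then have "c' \<le> f y" using d'(2) by blast
          then show ?thesis by linarith
        next
          case 3
          then have "y \<in> {x<..<x+d}" using y ab by auto
          then have "c \<le> f y" using d(2) by blast
          then show ?thesis by linarith
        qed auto
      qed
    qed (use d d' in auto)
  qed
  then show ?thesis by (simp add: bounded_on_def Int_absorb2)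
qed auto

lemma unbounded_running_infimum_iff:
  fixes f :: "real \<Rightarrow> real"
  assumes f: "cadlag f"
  shows "\<not> bounded ((\<lambda>t. - (INF s\<in>{0..t}. min (f s) 0)) ` {0..}) \<longleftrightarrow> (\<forall>c. \<exists>s\<ge>0. f s < c)"
proof -
  let ?M = "\<lambda>t. - (INF s\<in>{0..t}. min (f s) 0)"
  have bdd: "bdd_below ((\<lambda>s. min (f s) 0) ` {0..t})" for t
  proof -
    obtain m where "\<And>s. s \<in> {0..t} \<Longrightarrow> m \<le> f s"
      using cadlag_bdd_below[OF f, of t] unfolding bdd_below_def by blast
    then show ?thesis by (intro bdd_belowI2[of _ "min m 0"]) fastforce
  qed
  have "\<not> (\<forall>c. \<exists>s\<ge>0. f s < c)" if "bounded (?M ` {0..})"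
  proof -
    from that obtain B where B: "\<And>t. 0 \<le> t \<Longrightarrow> \<bar>?M t\<bar> \<le> B"
      by (auto simp: bounded_iff)
    have "- B \<le> f s" if "0 \<le> s" for s
      using B[OF that] cINF_lower[OF bdd, of s s] that by auto
    then show ?thesis by (auto simp: not_less)
  qed
  moreover have "bounded (?M ` {0..})" if "\<And>s. 0 \<le> s \<Longrightarrow> c \<le> f s" for c
  proof (rule boundedI)
    fix y assume "y \<in> ?M ` {0..}"
    then obtain t where t: "0 \<le> t" "y = ?M t" by auto
    have "min c 0 \<le> (INF s\<in>{0..t}. min (f s) 0)"
      using t(1) that by (intro cINF_greatest) fastforce+
    moreover have "(INF s\<in>{0..t}. min (f s) 0) \<le> 0"
      using cINF_lower[OF bdd, of t t] t(1) by auto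
    ultimately show "norm y \<le> - min c 0" using t(2) by simp
  qed
  ultimately show ?thesis by (meson not_less)
qed

text \<open>Since the path is bounded below on compact intervals, arbitrarily low values must also occur
  arbitrarily late.\<close>

lemma Liminf_eq_minus_infinity_iff:
  fixes f :: "real \<Rightarrow> real"
  assumes f: "cadlag f"
  shows "Liminf at_top (\<lambda>t. ereal (f t)) = -\<infinity> \<longleftrightarrow> (\<forall>c. \<exists>s\<ge>0. f s < c)"
proof
  assume L: "Liminf at_top (\<lambda>t. ereal (f t)) = -\<infinity>"
  show "\<forall>c. \<exists>s\<ge>0. f s < c"
  proof (rule ccontr)
    assume "\<not> (\<forall>c. \<exists>s\<ge>0. f s < c)"
    then obtain c where "\<And>s. 0 \<le> s \<Longrightarrow> c \<le> f s" by (auto simp: not_less)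
    then have "eventually (\<lambda>s. ereal c \<le> ereal (f s)) at_top"
      by (intro eventually_at_top_linorderI[of 0]) simp
    then have "ereal c \<le> Liminf at_top (\<lambda>t. ereal (f t))" by (rule Liminf_bounded)
    then show False using L by simp
  qed
next
  assume unb: "\<forall>c. \<exists>s\<ge>0. f s < c"
  show "Liminf at_top (\<lambda>t. ereal (f t)) = -\<infinity>"
  proof (rule ccontr)
    assume "\<not> ?thesis"
    then have "-\<infinity> < Liminf at_top (\<lambda>t. ereal (f t))" by simp
    then obtain c where "ereal c < Liminf at_top (\<lambda>t. ereal (f t))"
      using ereal_dense2 by blast
    then have "eventually (\<lambda>t. ereal c < ereal (f t)) at_top" by (rule less_LiminfD)
    then obtain T where T: "\<And>t. T \<le> t \<Longrightarrow> c < f t" by (auto simp: eventually_at_top_linorder)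
    obtain m where m: "\<And>s. s \<in> {0..T} \<Longrightarrow> m \<le> f s"
      using cadlag_bdd_below[OF f, of T] unfolding bdd_below_def by blast
    obtain s where s: "0 \<le> s" "f s < min c m" using unb by blast
    show False using T[of s] m[of s] s by (cases "s \<le> T") auto
  qed
qed

section \<open>Zeros of the reflected path\<close>

lemma is_reflectionD:
  assumes "is_reflection P X W L"
  shows "0 \<le> t \<Longrightarrow> W t $ i = X t $ i + L t $ i - (transpose P *v L t) $ i"
    and "0 \<le> s \<Longrightarrow> s \<le> t \<Longrightarrow> L s $ i \<le> L t $ i"
    and "0 \<le> t \<Longrightarrow> 0 \<le> L t $ i"
    and "0 \<le> t \<Longrightarrow> ((\<lambda>s. L s $ i) \<longlongrightarrow> L t $ i) (at_right t)"
    and "0 \<le> t \<Longrightarrow> 0 \<le> W t $ i"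
    and "(\<integral>\<^sup>+t\<in>{0..}. indicator {s. W s $ i > 0} t \<partial>stieltjes_measure (\<lambda>t. L t $ i)) = 0"
  using assms
  by (auto simp: is_reflection_def reflection_matrix_component mono_on_def)

text \<open>
  The closed interval matters: \<open>F\<close> may jump across the level \<open>c\<close> at \<open>\<tau>\<close> itself, and then the atom
  at \<open>\<tau>\<close> carries the mass. It is captured by shrinking half-open intervals from the left.
\<close>

lemma interval_measure_Icc_ge:
  fixes F :: "real \<Rightarrow> real"
  assumes mono: "\<And>x y. x \<le> y \<Longrightarrow> F x \<le> F y" and rc: "\<And>x. continuous (at_right x) F"
    and c: "\<And>u. u < \<tau> \<Longrightarrow> F u \<le> c" and t: "\<tau> \<le> t"
  shows "ennreal (F t - c) \<le> emeasure (interval_measure F) {\<tau>..t}"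
proof -
  define A where "A n = {\<tau> - 1 / (real n + 1) <.. t}" for n
  have Ioc: "emeasure (interval_measure F) (A n) = ennreal (F t - F (\<tau> - 1 / (real n + 1)))" for n
    unfolding A_def using t by (intro emeasure_interval_measure_Ioc mono rc) (smt (verit) divide_nonneg_nonneg of_nat_0_le_iff)
  have "{\<tau>..t} = (\<Inter>n. A n)"
  proof (intro equalityI subsetI)
    fix x assume x: "x \<in> (\<Inter>n. A n)"
    have "\<tau> \<le> x"
    proof (rule ccontr)
      assume "\<not> \<tau> \<le> x"
      then obtain n where "1 / (real n + 1) < \<tau> - x"
        using nat_approx_posE[of "\<tau> - x"] by (auto simp: add.commute)
      moreover have "x \<in> A n" using x by blast
      ultimately show False by (simp add: A_def)
    qed
    moreover have "x \<in> A 0" using x by blast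
    ultimately show "x \<in> {\<tau>..t}" by (simp add: A_def)
  next
    fix x assume x: "x \<in> {\<tau>..t}"
    show "x \<in> (\<Inter>n. A n)"
    proof
      fix n
      have "0 < 1 / (real n + 1)" by simp
      then have "\<tau> - 1 / (real n + 1) < x" using x by (simp only: atLeastAtMost_iff) linarith
      then show "x \<in> A n" using x by (simp add: A_def)
    qed
  qed
  moreover have "(INF n. emeasure (interval_measure F) (A n)) = emeasure (interval_measure F) (\<Inter>n. A n)"
  proof (rule INF_emeasure_decseq)
    show "decseq A"
    proof (rule decseq_SucI)
      fix n
      have "1 / (real (Suc n) + 1) \<le> 1 / (real n + 1)" by (intro divide_left_mono) auto
      then show "A (Suc n) \<subseteq> A n" by (auto simp: A_def)
    qed
    show "range A \<subseteq> sets (interval_measure F)" by (auto simp: A_def)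
  qed (simp add: Ioc)
  moreover have "ennreal (F t - c) \<le> (INF n. emeasure (interval_measure F) (A n))"
    unfolding Ioc using c by (intro INF_greatest ennreal_leI diff_left_mono) simp
  ultimately show ?thesis by simp
qed

text \<open>
  Let \<open>\<tau>\<close> be the first time at which \<open>L\<^sub>i\<close> passes the level \<open>c\<close>. The measure \<open>dL\<^sub>i\<close> gives positive
  mass to \<open>[\<tau>, t]\<close>, so complementarity does not allow \<open>W\<^sub>i\<close> to be positive on all of \<open>[\<tau>, t]\<close>.
\<close>

lemma reflection_zero_above_level:
  assumes refl: "is_reflection P X W L" and c: "0 \<le> c" "c < L t $ i" and t: "0 \<le> t"
  obtains s where "0 \<le> s" "s \<le> t" "W s $ i = 0" "c \<le> L s $ i"
proof -
  note D = is_reflectionD[OF refl]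
  \<comment> \<open>The extension by zero treats an initial atom of \<open>dL\<^sub>i\<close> at \<open>0\<close> like any other jump.\<close>
  define F where "F t = (if t < 0 then 0 else L t $ i)" for t
  have mono: "F x \<le> F y" if "x \<le> y" for x y
    using that D(2,3) by (auto simp: F_def)
  have rc: "continuous (at_right x) F" for x
  proof (cases "x < 0")
    case True
    have "(F \<longlongrightarrow> 0) (at_right x)"
      by (rule tendsto_eventually)
        (use True in \<open>auto simp: F_def eventually_at_right_field intro!: exI[of _ 0]\<close>)
    then show ?thesis using True by (simp add: continuous_within F_def)
  next
    case False
    have "((\<lambda>s. L s $ i) \<longlongrightarrow> F x) (at_right x)"
      using D(4)[of x i] False by (simp add: F_def)
    then have "(F \<longlongrightarrow> F x) (at_right x)"
      by (rule Lim_transform_eventually)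
        (use False in \<open>auto simp: F_def eventually_at_right_field intro!: exI[of _ "x + 1"]\<close>)
    then show ?thesis by (simp add: continuous_within)
  qed
  define S where "S = {s. c < F s}"
  define \<tau> where "\<tau> = Inf S"
  have S0: "0 \<le> s" if "s \<in> S" for s
    using that c(1) by (auto simp: S_def F_def split: if_splits)
  then have bdd: "bdd_below S" by (rule bdd_belowI)
  have tS: "t \<in> S" using c t by (simp add: S_def F_def)
  have \<tau>: "0 \<le> \<tau>" "\<tau> \<le> t"
    unfolding \<tau>_def using S0 tS bdd by (auto intro: cInf_greatest cInf_lower)
  have below: "F u \<le> c" if "u < \<tau>" for u
    using that cInf_lower[OF _ bdd, of u] by (force simp: \<tau>_def S_def not_less[symmetric])
  have above: "c < F s" if "\<tau> < s" for s
  proof -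
    from that obtain s' where "s' \<in> S" "s' < s"
      using tS bdd cInf_less_iff[of S s] unfolding \<tau>_def by blast
    then show ?thesis using mono[of s' s] by (simp add: S_def)
  qed
  have "c \<le> F \<tau>"
  proof (rule tendsto_lowerbound)
    show "(F \<longlongrightarrow> F \<tau>) (at_right \<tau>)" using rc[of \<tau>] by (simp add: continuous_within)
    show "eventually (\<lambda>s. c \<le> F s) (at_right \<tau>)"
      using above by (auto simp: eventually_at_right_field intro!: exI[of _ "\<tau> + 1"] less_imp_le)
  qed simp
  then have level: "c \<le> L s $ i" if "\<tau> \<le> s" for s
    using mono[OF that] \<tau>(1) that by (simp add: F_def)
  have "\<exists>s\<in>{\<tau>..t}. W s $ i = 0"
  proof (rule ccontr)
    assume no: "\<not> ?thesis"
    have pos: "0 < W s $ i" if "s \<in> {\<tau>..t}" for s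
      using no that D(5)[of s i] \<tau>(1) by (force simp: less_le)
    have "ennreal (F t - c) \<le> emeasure (interval_measure F) {\<tau>..t}"
      by (rule interval_measure_Icc_ge[OF mono rc below \<tau>(2)])
    also have "\<dots> = (\<integral>\<^sup>+s. indicator {\<tau>..t} s \<partial>interval_measure F)" by simp
    also have "\<dots> \<le> (\<integral>\<^sup>+s\<in>{0..}. indicator {s. W s $ i > 0} s \<partial>interval_measure F)"
      by (intro nn_integral_mono) (use pos \<tau>(1) in \<open>auto simp: indicator_def\<close>)
    also have "\<dots> = 0"
      using D(6)[of i] by (simp add: stieltjes_measure_def F_def[abs_def])
    finally show False using tS by (simp add: S_def)
  qed
  then obtain s where "s \<in> {\<tau>..t}" "W s $ i = 0" by blast
  then show thesis using that[of s] \<tau>(1) level by auto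
qed

text \<open>A level strictly above \<open>L\<^sub>i T\<close> can only be attained after time \<open>T\<close>.\<close>

lemma reflection_late_zero:
  assumes refl: "is_reflection P X W L" and unb: "\<forall>c. \<exists>t\<ge>0. c < L t $ i"
  obtains s where "0 \<le> s" "T \<le> s" "W s $ i = 0"
proof -
  note D = is_reflectionD[OF refl]
  define T' where "T' = max T 0"
  obtain t where t: "0 \<le> t" "L T' $ i < L t $ i" using unb by blast
  have "0 \<le> L T' $ i" using D(3) by (simp add: T'_def)
  then obtain s where s: "0 \<le> s" "W s $ i = 0" "(L T' $ i + L t $ i) / 2 \<le> L s $ i"
    using reflection_zero_above_level[OF refl, of "(L T' $ i + L t $ i) / 2" t i] t by auto
  then have "\<not> s \<le> T'" using D(2)[of s T' i] t by force
  then show thesis using that s by (auto simp: T'_def)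
qed

section \<open>Comparison of two initial conditions\<close>

locale shifted_reflections =
  fixes P :: "real^'n^'n" and X W L W' L' :: "real \<Rightarrow> real^'n" and a :: "real^'n"
  assumes P: "\<forall>j k. 0 \<le> P $ j $ k" "spec_radius P < 1"
    and a: "\<And>j. 0 \<le> a $ j"
    and refl: "is_reflection P X W L"
    and refl': "is_reflection P (\<lambda>t. a + X t) W' L'"
begin

definition D :: "real \<Rightarrow> real^'n" where "D t = L t - L' t"

definition A :: "real \<Rightarrow> real^'n" where "A t = a + transpose P *v D t"

text \<open>
  With the extension of \<open>D\<close> by \<open>0\<close> to negative times, nonnegativity of \<open>D\<close> becomes an instance of
  monotonicity.
\<close>

definition D0 :: "real \<Rightarrow> real^'n" where "D0 t = (if t < 0 then 0 else D t)"

lemma difference_eq: "0 \<le> t \<Longrightarrow> W' t $ i - W t $ i = A t $ i - D t $ i"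
  using is_reflectionD(1)[OF refl, of t i] is_reflectionD(1)[OF refl', of t i]
  by (simp add: A_def D_def matrix_vector_mult_diff_distrib)

text \<open>
  The pushing \<open>L\<^sub>i\<close> up to time \<open>t\<close> was, up to \<open>\<epsilon>\<close>, already reached at a zero of \<open>W\<^sub>i\<close>, where
  \<open>A\<^sub>i - D\<^sub>i = W'\<^sub>i \<ge> 0\<close>; since then \<open>L'\<^sub>i\<close> has only grown.
\<close>

lemma D_le_earlier_A:
  assumes t: "0 \<le> t" and L: "0 < L t $ i" and \<epsilon>: "0 < \<epsilon>"
  obtains s where "0 \<le> s" "s \<le> t" "D t $ i \<le> A s $ i + \<epsilon>"
proof -
  obtain s where s: "0 \<le> s" "s \<le> t" "W s $ i = 0" "max 0 (L t $ i - \<epsilon>) \<le> L s $ i"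
    using reflection_zero_above_level[OF refl, of "max 0 (L t $ i - \<epsilon>)" t i] t L \<epsilon> by auto
  have "D s $ i \<le> A s $ i"
    using difference_eq[OF s(1), of i] is_reflectionD(5)[OF refl' s(1), of i] s(3) by simp
  moreover have "L' s $ i \<le> L' t $ i" by (rule is_reflectionD(2)[OF refl' s(1,2)])
  ultimately show thesis using that[of s] s by (simp add: D_def)
qed

text \<open>
  The mirror image, with the roles of the two reflections exchanged. The level \<open>c\<close> serves to
  locate \<open>s\<close> later than any time at which \<open>L'\<^sub>i\<close> is at most \<open>c\<close>.
\<close>

lemma D_ge_earlier_A:
  assumes t: "0 \<le> t" and c: "0 \<le> c" "c < L' t $ i" and \<epsilon>: "0 < \<epsilon>"
  obtains s where "0 \<le> s" "s \<le> t" "c < L' s $ i" "A s $ i - \<epsilon> \<le> D t $ i"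
proof -
  \<comment> \<open>The midpoint keeps \<open>c'\<close> strictly between \<open>c\<close> and \<open>L'\<^sub>i t\<close> even when \<open>\<epsilon>\<close> is large.\<close>
  define c' where "c' = max ((c + L' t $ i) / 2) (L' t $ i - \<epsilon>)"
  have c': "c < c'" "c' < L' t $ i" "L' t $ i - \<epsilon> \<le> c'"
    using c \<epsilon> by (auto simp: c'_def max_def field_simps)
  obtain s where s: "0 \<le> s" "s \<le> t" "W' s $ i = 0" "c' \<le> L' s $ i"
    using reflection_zero_above_level[OF refl', of c' t i] t c c' by auto
  have "A s $ i \<le> D s $ i"
    using difference_eq[OF s(1), of i] is_reflectionD(5)[OF refl s(1), of i] s(3) by simp
  moreover have "L s $ i \<le> L t $ i" by (rule is_reflectionD(2)[OF refl s(1,2)])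
  ultimately show thesis using that[of s] s c' by (simp add: D_def)
qed

text \<open>
  Let \<open>e\<close> collect the largest drops of the components of \<open>D\<close> up to a fixed time. A drop of \<open>D\<^sub>i\<close>
  from \<open>s\<close> to \<open>t\<close> requires \<open>L'\<^sub>i\<close> to increase between these times, so, unless \<open>L\<^sub>i\<close> is still zero at
  \<open>s\<close>, there are \<open>s1 \<le> s < t1 \<le> t\<close> with \<open>D\<^sub>i s \<le> A\<^sub>i s1\<close> and \<open>A\<^sub>i t1 \<le> D\<^sub>i t\<close>, up to \<open>\<epsilon>\<close>. The drop is thus at most
  \<open>A\<^sub>i s1 - A\<^sub>i t1 = (P\<^sup>t (D s1 - D t1))\<^sub>i \<le> (P\<^sup>t e)\<^sub>i\<close>. Hence \<open>e \<le> P\<^sup>t e\<close>, which forces \<open>e \<le> 0\<close>.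
\<close>

lemma D0_mono:
  assumes st: "s \<le> t"
  shows "D0 s $ i \<le> D0 t $ i"
proof (cases "t < 0")
  case True
  then show ?thesis using st by (simp add: D0_def)
next
  case False
  define T where "T = t"
  have T: "0 \<le> T" using False by (simp add: T_def)
  note LD = is_reflectionD(2,3)[OF refl] and LD' = is_reflectionD(2,3)[OF refl']
  define drops where "drops j = (\<lambda>(s, t). D0 s $ j - D0 t $ j) ` {(s, t). s \<le> t \<and> t \<le> T}" for j
  define e :: "real^'n" where "e = (\<chi> j. Sup (drops j))"
  have D0_bounds: "D0 r $ j \<le> L T $ j" "- D0 r $ j \<le> L' T $ j" if "r \<le> T" for r j
    using LD(1)[of r T j] LD(2)[of r j] LD'(1)[of r T j] LD'(2)[of r j]
      LD(2)[OF T, of j] LD'(2)[OF T, of j] that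
    by (auto simp: D0_def D_def)
  have "bdd_above (drops j)" for j
  proof (rule bdd_aboveI)
    fix y assume "y \<in> drops j"
    then obtain s t where "s \<le> t" "t \<le> T" "y = D0 s $ j - D0 t $ j" by (auto simp: drops_def)
    then show "y \<le> L T $ j + L' T $ j"
      using D0_bounds(1)[of s j] D0_bounds(2)[of t j] by simp
  qed
  then have e_upper: "D0 s $ j - D0 t $ j \<le> e $ j" if "s \<le> t" "t \<le> T" for s t j
    using that by (auto simp: e_def drops_def intro!: cSup_upper image_eqI[of _ _ "(s, t)"])
  have e_nonneg: "0 \<le> e $ j" for j using e_upper[of T T j] by simp
  have drop_le: "D0 s $ i - D0 t $ i \<le> (transpose P *v e) $ i" if st: "s \<le> t" "t \<le> T" for s t i
  proof (cases "t < 0")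
    case True
    then show ?thesis
      using st transpose_mult_mono[OF P(1), of 0 e i] e_nonneg by (simp add: D0_def)
  next
    case False
    then have t0: "0 \<le> t" by simp
    define c where "c = (if s < 0 then 0 else L' s $ i)"
    have c0: "0 \<le> c" using LD'(2) by (simp add: c_def)
    show ?thesis
    proof (cases "c < L' t $ i")
      case False
      have "D0 s $ i \<le> D0 t $ i"
        using False st t0 LD(1)[of s t i] LD(2)[OF t0, of i]
        by (auto simp: D0_def D_def c_def split: if_splits)
      then show ?thesis
        using transpose_mult_mono[OF P(1), of 0 e i] e_nonneg by simp
    next
      case True
      show ?thesis
      proof (rule field_le_epsilon)
        fix \<epsilon> :: real assume "0 < \<epsilon>"
        then have \<epsilon>: "0 < \<epsilon> / 2" by simp
        obtain t1 where t1: "0 \<le> t1" "t1 \<le> t" "c < L' t1 $ i" "A t1 $ i - \<epsilon> / 2 \<le> D t $ i"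
          using D_ge_earlier_A[OF t0 c0 True \<epsilon>] .
        have st1: "s \<le> t1"
          using t1 LD'(1)[of t1 s i] by (cases "s < 0"; cases "s \<le> t1") (auto simp: c_def)
        show "D0 s $ i - D0 t $ i \<le> (transpose P *v e) $ i + \<epsilon>"
        proof (cases "s < 0 \<or> L s $ i \<le> 0")
          case True
          \<comment> \<open>Nothing has been pushed yet at time \<open>s\<close>; time \<open>-1\<close>, where \<open>D0 = 0\<close>, replaces \<open>s1\<close>.\<close>
          then have "D0 s $ i \<le> 0"
            using LD'(2)[of s i] by (auto simp: D0_def D_def)
          moreover have "(transpose P *v (- D t1)) $ i \<le> (transpose P *v e) $ i"
          proof (rule transpose_mult_mono[OF P(1)])
            fix j show "(- D t1) $ j \<le> e $ j"
              using e_upper[of "-1" t1 j] t1 st by (simp add: D0_def)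
          qed
          moreover have "transpose P *v (- D t1) = - (transpose P *v D t1)"
            using matrix_vector_mult_diff_distrib[of "transpose P" 0 "D t1"] by simp
          ultimately show ?thesis
            using t1(4) a[of i] t0 \<epsilon> by (simp add: A_def D0_def)
        next
          case False
          then obtain s1 where s1: "0 \<le> s1" "s1 \<le> s" "D s $ i \<le> A s1 $ i + \<epsilon> / 2"
            using D_le_earlier_A[of s i, OF _ _ \<epsilon>] by auto
          have "(transpose P *v (D s1 - D t1)) $ i \<le> (transpose P *v e) $ i"
          proof (rule transpose_mult_mono[OF P(1)])
            fix j show "(D s1 - D t1) $ j \<le> e $ j"
              using e_upper[of s1 t1 j] t1 st s1 st1 by (simp add: D0_def)
          qed
          then show ?thesis
            using t1(4) s1 t0 False by (simp add: A_def D0_def matrix_vector_mult_diff_distrib)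
        qed
      qed
    qed
  qed
  have "Sup (drops j) \<le> (transpose P *v e) $ j" for j
  proof (rule cSup_least)
    show "drops j \<noteq> {}" by (auto simp: drops_def)
  qed (use drop_le in \<open>auto simp: drops_def simp del: transpose_matrix_vector\<close>)
  then have "e $ j \<le> (transpose P *v e) $ j" for j by (simp add: e_def)
  then have "e $ i \<le> 0"
    by - (rule reflection_matrix_monotone[OF P], simp add: reflection_matrix_component)
  then show ?thesis using e_upper[OF st, of i] by (simp add: T_def)
qed

lemma D_mono: "0 \<le> s \<Longrightarrow> s \<le> t \<Longrightarrow> D s $ i \<le> D t $ i"
  using D0_mono[of s t i] by (simp add: D0_def)

lemma D_nonneg: "0 \<le> t \<Longrightarrow> 0 \<le> D t $ i"
  using D0_mono[of "-1" t i] by (simp add: D0_def)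

text \<open>
  Once \<open>D\<close>, and hence \<open>A\<close>, is known to be nondecreasing, \<open>D\<^sub>i t \<le> A\<^sub>i s \<le> A\<^sub>i t\<close> up to \<open>\<epsilon>\<close>. So
  \<open>R D \<le> a\<close>, and inverse positivity of \<open>R\<close> applies.
\<close>

lemma D_bounded:
  assumes t: "0 \<le> t"
  shows "D t $ i \<le> (matrix_inv (reflection_matrix P) *v a) $ i"
proof -
  have "D t $ i \<le> A t $ i" for i
  proof (cases "0 < L t $ i")
    case False
    have "0 \<le> (transpose P *v D t) $ i"
      using transpose_mult_mono[OF P(1), of 0 "D t" i] D_nonneg[OF t] by simp
    then show ?thesis
      using False is_reflectionD(3)[OF refl' t, of i] a[of i] by (simp add: A_def D_def)
  next
    case True
    show ?thesis
    proof (rule field_le_epsilon)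
      fix \<epsilon> :: real assume "0 < \<epsilon>"
      then obtain s where s: "0 \<le> s" "s \<le> t" "D t $ i \<le> A s $ i + \<epsilon>"
        using D_le_earlier_A[OF t True] by blast
      moreover have "A s $ i \<le> A t $ i"
        using transpose_mult_mono[OF P(1), of "D s" "D t" i] D_mono[OF s(1,2)] by (simp add: A_def)
      ultimately show "D t $ i \<le> A t $ i + \<epsilon>" by simp
    qed
  qed
  then have "(reflection_matrix P *v D t) $ j \<le> a $ j" for j
    by (simp add: reflection_matrix_component A_def algebra_simps)
  then have "(D t - matrix_inv (reflection_matrix P) *v a) $ i \<le> 0"
    by - (rule reflection_matrix_monotone[OF P],
        simp add: matrix_vector_mult_diff_distrib reflection_matrix_inv_right[OF P])
  then show ?thesis by simp
qed

lemma difference_convergent: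
  obtains z where "((\<lambda>t. W' t $ i - W t $ i) \<longlongrightarrow> z) at_top"
proof -
  define d :: "real^'n" where "d = (\<chi> j. SUP t\<in>{0..}. D t $ j)"
  have bdd: "bdd_above ((\<lambda>t. D t $ j) ` {0..})" for j
    by (rule bdd_aboveI2[OF D_bounded]) simp
  have "((\<lambda>t. D t $ j) \<longlongrightarrow> d $ j) at_top" for j
  proof (rule order_tendstoI)
    fix y assume "y < d $ j"
    then obtain t where t: "0 \<le> t" "y < D t $ j"
      using bdd[of j] by (auto simp: d_def less_cSUP_iff)
    then show "eventually (\<lambda>t. y < D t $ j) at_top"
      using less_le_trans[OF t(2) D_mono[OF t(1)]] by (intro eventually_at_top_linorderI[of t])
  next
    fix y assume "d $ j < y"
    moreover have "D t $ j \<le> d $ j" if "0 \<le> t" for t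
      using cSUP_upper[OF _ bdd[of j], of t] that by (simp add: d_def)
    ultimately show "eventually (\<lambda>t. D t $ j < y) at_top"
      by (intro eventually_at_top_linorderI[of 0]) (rule le_less_trans)
  qed
  then have lim: "(D \<longlongrightarrow> d) at_top" by (rule vec_tendstoI)
  have "((\<lambda>t. transpose P *v D t) \<longlongrightarrow> transpose P *v d) at_top"
    by (rule bounded_linear.tendsto[OF matrix_vector_mul_bounded_linear lim])
  then have "((\<lambda>t. (A t - D t) $ i) \<longlongrightarrow> (a + transpose P *v d - d) $ i) at_top"
    unfolding A_def by (intro tendsto_vec_nth tendsto_diff tendsto_add tendsto_const lim)
  then have "((\<lambda>t. W' t $ i - W t $ i) \<longlongrightarrow> (a + transpose P *v d - d) $ i) at_top"
    by (rule Lim_transform_eventually)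
      (auto intro!: eventually_at_top_linorderI[of 0] simp: difference_eq)
  then show thesis using that by blast
qed

lemma difference_tendsto_0:
  assumes unb: "\<forall>c. \<exists>t\<ge>0. c < L t $ i" and unb': "\<forall>c. \<exists>t\<ge>0. c < L' t $ i"
  shows "((\<lambda>t. W' t $ i - W t $ i) \<longlongrightarrow> 0) at_top"
proof -
  obtain z where z: "((\<lambda>t. W' t $ i - W t $ i) \<longlongrightarrow> z) at_top"
    by (rule difference_convergent)
  have "\<not> 0 < z"
  proof
    assume "0 < z"
    then obtain T where T: "\<And>t. T \<le> t \<Longrightarrow> 0 < W' t $ i - W t $ i"
      using order_tendstoD(1)[OF z, of 0] unfolding eventually_at_top_linorder by blast
    obtain s where "0 \<le> s" "T \<le> s" "W' s $ i = 0" by (rule reflection_late_zero[OF refl' unb'])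
    then show False using T[of s] is_reflectionD(5)[OF refl, of s i] by simp
  qed
  moreover have "\<not> z < 0"
  proof
    assume "z < 0"
    then obtain T where T: "\<And>t. T \<le> t \<Longrightarrow> W' t $ i - W t $ i < 0"
      using order_tendstoD(2)[OF z, of 0] unfolding eventually_at_top_linorder by blast
    obtain s where "0 \<le> s" "T \<le> s" "W s $ i = 0" by (rule reflection_late_zero[OF refl unb])
    then show False using T[of s] is_reflectionD(5)[OF refl', of s i] by simp
  qed
  ultimately show ?thesis using z by (simp add: not_less order_antisym)
qed

end

section \<open>Unboundedness of the regulator\<close>

text \<open>Both criteria read off a lower bound for \<open>L\<^sub>i\<close> from a nonnegative quantity: \<open>W\<^sub>i\<close> itself, where
  the other components of \<open>L\<close> can only pull down, or \<open>(R\<^sup>-\<^sup>1 W)\<^sub>i = (R\<^sup>-\<^sup>1 X)\<^sub>i + L\<^sub>i\<close>.\<close>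

lemma reflection_unbounded_of_path:
  assumes P: "\<forall>j k. 0 \<le> P $ j $ k" and refl: "is_reflection P X W L"
    and X: "\<forall>c. \<exists>t\<ge>0. X t $ i < c"
  shows "\<forall>c. \<exists>t\<ge>0. c < L t $ i"
proof
  fix c
  obtain t where t: "0 \<le> t" "X t $ i < - c" using X by blast
  have "0 \<le> (transpose P *v L t) $ i"
    using transpose_mult_mono[OF P, of 0 "L t" i] is_reflectionD(3)[OF refl t(1)] by simp
  then have "c < L t $ i"
    using is_reflectionD(1,5)[OF refl t(1), of i] t(2) by simp
  with t(1) show "\<exists>t\<ge>0. c < L t $ i" by blast
qed

lemma reflection_unbounded_of_inverse_path:
  assumes P: "\<forall>j k. 0 \<le> P $ j $ k" "spec_radius P < 1" and refl: "is_reflection P X W L"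
    and X: "\<forall>c. \<exists>t\<ge>0. (matrix_inv (reflection_matrix P) *v X t) $ i < c"
  shows "\<forall>c. \<exists>t\<ge>0. c < L t $ i"
proof
  fix c
  let ?G = "matrix_inv (reflection_matrix P)"
  obtain t where t: "0 \<le> t" "(?G *v X t) $ i < - c" using X by blast
  have "W t = X t + reflection_matrix P *v L t"
    using refl t(1) by (simp add: is_reflection_def)
  then have "?G *v W t = ?G *v X t + L t"
    by (simp add: matrix_vector_right_distrib reflection_matrix_inv_left[OF P])
  moreover have "0 \<le> (?G *v W t) $ i"
    by (rule reflection_matrix_inv_nonneg[OF P]) (rule is_reflectionD(5)[OF refl t(1)])
  ultimately have "c < L t $ i" using t(2) by simp
  with t(1) show "\<exists>t\<ge>0. c < L t $ i" by blast
qed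

lemma unbounded_below_shift:
  fixes f :: "real \<Rightarrow> real"
  assumes "\<forall>c. \<exists>t\<ge>0. f t < c"
  shows "\<forall>c. \<exists>t\<ge>0. b + f t < c"
proof
  fix c
  obtain t where "t \<ge> 0" "f t < c - b" using assms by blast
  then show "\<exists>t\<ge>0. b + f t < c" by (intro exI[of _ t]) simp
qed

theorem theorem2p4:
  fixes P :: "real^'n^'n" and X :: "real \<Rightarrow> real^'n" and i :: 'n
  assumes "\<forall>j k. 0 \<le> P $ j $ k"
    and "spec_radius P < 1"
    and "cadlag X"
  shows "(\<not> bounded (M_path X i ` {0..}) \<longleftrightarrow>
            Liminf at_top (\<lambda>t. ereal (X t $ i)) = -\<infinity>) \<and>
         (\<not> bounded (N_path P X i ` {0..}) \<longleftrightarrow>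
            Liminf at_top (\<lambda>t. ereal ((matrix_inv (reflection_matrix P) *v X t) $ i)) = -\<infinity>) \<and>
         (\<not> bounded (M_path X i ` {0..}) \<or> \<not> bounded (N_path P X i ` {0..}) \<longrightarrow>
            (\<forall>a W L W' L'. (\<forall>j. 0 \<le> a $ j) \<longrightarrow>
               is_reflection P X W L \<longrightarrow>
               is_reflection P (\<lambda>t. a + X t) W' L' \<longrightarrow>
               ((\<lambda>t. W' t $ i - W t $ i) \<longlongrightarrow> 0) at_top))"
proof -
  let ?G = "matrix_inv (reflection_matrix P)"
  note P = assms(1,2)
  have X: "cadlag (\<lambda>t. X t $ i)"
    by (rule cadlag_continuous_compose[OF assms(3)]) (intro continuous_intros)
  have GX: "cadlag (\<lambda>t. (?G *v X t) $ i)"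
    by (rule cadlag_continuous_compose[OF assms(3)])
      (intro continuous_intros linear_continuous_on matrix_vector_mul_bounded_linear)
  have M: "\<not> bounded (M_path X i ` {0..}) \<longleftrightarrow> (\<forall>c. \<exists>t\<ge>0. X t $ i < c)"
    using unbounded_running_infimum_iff[OF X] by (simp add: M_path_def[abs_def])
  have N: "\<not> bounded (N_path P X i ` {0..}) \<longleftrightarrow> (\<forall>c. \<exists>t\<ge>0. (?G *v X t) $ i < c)"
    using unbounded_running_infimum_iff[OF GX] by (simp add: N_path_def[abs_def])
  have "((\<lambda>t. W' t $ i - W t $ i) \<longlongrightarrow> 0) at_top"
    if unb: "(\<forall>c. \<exists>t\<ge>0. X t $ i < c) \<or> (\<forall>c. \<exists>t\<ge>0. (?G *v X t) $ i < c)"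
      and a: "\<forall>j. 0 \<le> a $ j"
      and sol: "is_reflection P X W L" "is_reflection P (\<lambda>t. a + X t) W' L'" for a W L W' L'
  proof -
    interpret shifted_reflections P X W L W' L' a
      using P a sol by unfold_locales auto
    have "(\<forall>c. \<exists>t\<ge>0. c < L t $ i) \<and> (\<forall>c. \<exists>t\<ge>0. c < L' t $ i)"
      using unb
    proof
      assume "\<forall>c. \<exists>t\<ge>0. X t $ i < c"
      then show ?thesis
        using unbounded_below_shift[of "\<lambda>t. X t $ i" "a $ i"]
          reflection_unbounded_of_path[OF P(1) sol(1)]
          reflection_unbounded_of_path[OF P(1) sol(2), of i] by simp
    next
      assume "\<forall>c. \<exists>t\<ge>0. (?G *v X t) $ i < c"
      then show ?thesis
        using unbounded_below_shift[of "\<lambda>t. (?G *v X t) $ i" "(?G *v a) $ i"]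
          reflection_unbounded_of_inverse_path[OF P sol(1)]
          reflection_unbounded_of_inverse_path[OF P sol(2), of i]
        by (simp add: matrix_vector_right_distrib)
    qed
    then show ?thesis using difference_tendsto_0 by blast
  qed
  then show ?thesis
    using M N Liminf_eq_minus_infinity_iff[OF X] Liminf_eq_minus_infinity_iff[OF GX] by blast
qed

end
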